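(* For every integer $k \geq 1$ there exists a constant $c$ depending only on $k$ such that for all integers $t \geq 2$ and $m \geq 3$, $$r_k(K_{2,t};K_m) \leq c\,\frac{m^2 t}{\log^2 m}.$$
   Context: For graphs $H, G$ and an integer $k\ge 1$, the Ramsey number $r_k(H;G)$ is the minimum integer $r$ such that in every edge-coloring of the complete graph $K_r$ with $k+1$ colors, there is a monochromatic copy of $H$ in one of the first $k$ colors or a copy of $G$ in the $(k+1)$-st color (copies are not necessarily induced subgraphs). $K_{2,t}$ is the complete bipartite graph with parts of sizes $2$ and $t$; $K_m$ is the complete graph on $m$ vertices. Logarithms are natural, and $\log^2 x$ means $(\log x)^2$. *)

theory Defs
  imports Complex_Main "HOL-Library.Ramsey"
begin

(* Simple graphs: an edge is a two-element set of vertices, i.e. an element of nsets V 2. *)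
datatype 'a graph = Graph (verts: "'a set") (edges: "'a set set")

definition complete_graph :: "nat \<Rightarrow> nat graph" where
  "complete_graph n = Graph {..<n} (nsets {..<n} 2)"

definition complete_bipartite :: "nat \<Rightarrow> nat \<Rightarrow> (nat + nat) graph" where
  "complete_bipartite s t =
     Graph ({..<s} <+> {..<t}) {{Inl i, Inr j} |i j. i < s \<and> j < t}"

(* A copy need not be induced: edges map to edges, but non-edges are unconstrained. *)
definition contains_copy :: "'b graph \<Rightarrow> 'a graph \<Rightarrow> bool" where
  "contains_copy G H \<longleftrightarrow>
     (\<exists>f. inj_on f (verts H) \<and> f ` verts H \<subseteq> verts G \<and> (\<forall>e\<in>edges H. f ` e \<in> edges G))"

definition colour_class :: "'a graph \<Rightarrow> ('a set \<Rightarrow> nat) \<Rightarrow> nat \<Rightarrow> 'a graph" where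
  "colour_class G col i = Graph (verts G) {e \<in> edges G. col e = i}"

(* The k + 1 colours are 0, ..., k; the first k of them are 0, ..., k - 1. *)
definition ramsey_prop :: "nat \<Rightarrow> 'a graph \<Rightarrow> 'b graph \<Rightarrow> nat \<Rightarrow> bool" where
  "ramsey_prop k H G r \<longleftrightarrow>
     (\<forall>col \<in> edges (complete_graph r) \<rightarrow> {..<k + 1}.
        (\<exists>i<k. contains_copy (colour_class (complete_graph r) col i) H) \<or>
        contains_copy (colour_class (complete_graph r) col k) G)"

(* LEAST is unspecified if no r qualifies, so an upper bound on ramsey_number
   can only be derived by exhibiting some r with ramsey_prop k H G r. *)
definition ramsey_number :: "nat \<Rightarrow> 'a graph \<Rightarrow> 'b graph \<Rightarrow> nat" where
  "ramsey_number k H G = (LEAST r. ramsey_prop k H G r)"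

end

theory Submission
  imports Defs
begin

text \<open>
  Let \<open>E\<close> be the union of the first \<open>k\<close> colour classes on \<open>r\<close> vertices, none of which contains
  \<open>K\<^sub>2\<^sub>,\<^sub>t\<close>; a copy of \<open>K\<^sub>m\<close> in the last colour is an \<open>E\<close>-independent set of size \<open>m\<close>.
  Counting paths of length two shows that any \<open>s\<close> vertices span an \<open>E\<close>-graph of average degree
  at most \<open>2k sqrt (ts)\<close>. Hence at least half of the vertices have degree at most \<open>D = 4k sqrt (tr)\<close>,
  and among these every subset of a neighbourhood spans average degree at most
  \<open>a = 2k sqrt (tD)\<close>, which is much smaller than \<open>D\<close>.

  Such a locally sparse graph on \<open>n\<close> vertices has an independent set of size at least
  \<open>n ln (D/4a) / 16D\<close>. Choose a random independent set \<open>I\<close> with probability proportional to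
  \<open>l^|I|\<close>, where \<open>l = 1/4a\<close>. For a vertex \<open>v\<close>, condition on \<open>I\<close> outside the closed neighbourhood
  of \<open>v\<close>, and let \<open>W\<close> be the set of neighbours of \<open>v\<close> that can still be chosen. If \<open>W\<close> is large,
  then many neighbours are expected in \<open>I\<close>; if it is small, then \<open>v\<close> itself is likely to be in \<open>I\<close>.
  In both cases \<open>D P(v \<in> I) + E|N(v) \<inter> I| \<ge> ln (D/4a) / 8\<close>, and the sum over \<open>v\<close> of the left-hand
  side is at most \<open>2D E|I|\<close>.
\<close>

section \<open>Independent sets and the hard-core partition function\<close>

text \<open>A graph is a relation together with a vertex set, so passing to an induced subgraph
  changes only the set.\<close>

definition indep_sets :: "('a \<Rightarrow> 'a \<Rightarrow> bool) \<Rightarrow> 'a set \<Rightarrow> 'a set set" where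
  "indep_sets E W = {I. I \<subseteq> W \<and> (\<forall>u\<in>I. \<forall>v\<in>I. \<not> E u v)}"

text \<open>The independence polynomial at \<open>l\<close>, which normalizes the random independent
  set. Expectations appear below as weighted sums not divided by it.\<close>

definition hard_core :: "('a \<Rightarrow> 'a \<Rightarrow> bool) \<Rightarrow> real \<Rightarrow> 'a set \<Rightarrow> real" where
  "hard_core E l W = (\<Sum>I\<in>indep_sets E W. l ^ card I)"

definition nbrs :: "('a \<Rightarrow> 'a \<Rightarrow> bool) \<Rightarrow> 'a set \<Rightarrow> 'a \<Rightarrow> 'a set" where
  "nbrs E W u = {w \<in> W. E u w}"

lemma finite_indep_sets [simp]: "finite W \<Longrightarrow> finite (indep_sets E W)"
  unfolding indep_sets_def by (rule finite_subset[of _ "Pow W"]) auto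

lemma finite_nbrs [simp]: "finite W \<Longrightarrow> finite (nbrs E W u)"
  by (simp add: nbrs_def)

lemma empty_in_indep_sets [simp]: "{} \<in> indep_sets E W"
  by (simp add: indep_sets_def)

lemma finite_of_indep_sets: "I \<in> indep_sets E W \<Longrightarrow> finite W \<Longrightarrow> finite I"
  by (auto simp: indep_sets_def intro: finite_subset)

lemma hard_core_ge_1:
  fixes W :: "'a set"
  assumes "finite W" "l \<ge> 0"
  shows "hard_core E l W \<ge> 1"
proof -
  have "(\<Sum>I\<in>{{} :: 'a set}. l ^ card I) \<le> hard_core E l W"
    unfolding hard_core_def using assms by (intro sum_mono2) auto
  then show ?thesis by simp
qed

lemma hard_core_mono:
  assumes "finite W" "l \<ge> 0" "U \<subseteq> W"
  shows "hard_core E l U \<le> hard_core E l W"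
  unfolding hard_core_def using assms
  by (intro sum_mono2) (auto simp: indep_sets_def)

lemma sum_power_card_Pow:
  fixes l :: real
  assumes "finite W"
  shows "(\<Sum>I\<in>Pow W. l ^ card I) = (1 + l) ^ card W"
  using assms
proof (induction W rule: finite_induct)
  case (insert x W)
  have "(\<Sum>I\<in>Pow (insert x W). l ^ card I)
      = (\<Sum>I\<in>Pow W. l ^ card I) + (\<Sum>I\<in>insert x ` Pow W. l ^ card I)"
    unfolding Pow_insert using insert by (intro sum.union_disjoint) auto
  also have "(\<Sum>I\<in>insert x ` Pow W. l ^ card I) = (\<Sum>I\<in>Pow W. l ^ card (insert x I))"
    using insert by (subst sum.reindex) (auto simp: inj_on_def)
  also have "\<dots> = (\<Sum>I\<in>Pow W. l * l ^ card I)"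
  proof (rule sum.cong)
    fix I assume "I \<in> Pow W"
    then have "finite I" "x \<notin> I"
      using insert finite_subset by auto
    then show "l ^ card (insert x I) = l * l ^ card I" by simp
  qed simp
  finally show ?case
    using insert by (simp add: sum_distrib_left[symmetric] algebra_simps)
qed simp

text \<open>Dropping independence leaves the sum over all subsets, which is
  \<open>(1 + l) ^ card W\<close>.\<close>

lemma hard_core_le_exp:
  assumes "finite W" "l \<ge> 0"
  shows "hard_core E l W \<le> exp (l * card W)"
proof -
  have "hard_core E l W \<le> (\<Sum>I\<in>Pow W. l ^ card I)"
    unfolding hard_core_def using assms by (intro sum_mono2) (auto simp: indep_sets_def)
  also have "\<dots> = (1 + l) ^ card W"
    using assms sum_power_card_Pow by auto
  also have "\<dots> \<le> exp l ^ card W"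
    using assms by (intro power_mono exp_ge_add_one_self) auto
  also have "\<dots> = exp (l * card W)"
    by (metis exp_of_nat_mult mult.commute)
  finally show ?thesis .
qed

lemma sum_UN_le:
  fixes f :: "'b \<Rightarrow> real"
  assumes "finite B" "\<And>b. b \<in> B \<Longrightarrow> finite (C b)" "\<And>x. f x \<ge> 0"
  shows "sum f (\<Union>b\<in>B. C b) \<le> (\<Sum>b\<in>B. sum f (C b))"
  using assms(1,2)
proof (induction B rule: finite_induct)
  case (insert b B)
  have "sum f (C b \<union> (\<Union>b\<in>B. C b)) \<le> sum f (C b) + sum f (\<Union>b\<in>B. C b)"
    using insert assms(3) by (subst sum.union_inter[symmetric]) (auto intro!: sum_nonneg)
  then show ?case using insert by fastforce
qed simp

section \<open>Occupancy estimates in a simple graph\<close>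

locale simple_adj =
  fixes E :: "'a \<Rightarrow> 'a \<Rightarrow> bool"
  assumes sym: "E u v \<Longrightarrow> E v u" and irrefl: "\<not> E u u"
begin

text \<open>Deleting \<open>u\<close> is a bijection onto the independent sets that avoid its closed
  neighbourhood, and it costs one factor \<open>l\<close>.\<close>

lemma sum_indep_sets_containing:
  fixes l :: real
  assumes "finite W" "u \<in> W"
  shows "(\<Sum>I\<in>{I \<in> indep_sets E W. u \<in> I}. l ^ card I)
       = l * hard_core E l (W - insert u (nbrs E W u))"
proof -
  let ?U = "W - insert u (nbrs E W u)"
  have "(\<Sum>I\<in>{I \<in> indep_sets E W. u \<in> I}. l ^ card I) = (\<Sum>I\<in>indep_sets E ?U. l * l ^ card I)"
  proof (rule sum.reindex_bij_witness[of _ "insert u" "\<lambda>I. I - {u}"])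
    fix I assume I: "I \<in> {I \<in> indep_sets E W. u \<in> I}"
    then show "I - {u} \<in> indep_sets E ?U"
      by (auto simp: indep_sets_def nbrs_def)
    have "finite I" using I assms finite_of_indep_sets by auto
    then have "card I = Suc (card (I - {u}))"
      using I card.remove by fastforce
    then show "l * l ^ card (I - {u}) = l ^ card I" by simp
  next
    fix J assume J: "J \<in> indep_sets E ?U"
    then show "insert u J \<in> {I \<in> indep_sets E W. u \<in> I}"
      using assms irrefl sym by (auto simp: indep_sets_def nbrs_def)
    show "insert u J - {u} = J" using J by (auto simp: indep_sets_def)
  qed auto
  then show ?thesis by (simp add: hard_core_def sum_distrib_left)
qed

text \<open>Union bound: an independent set that meets \<open>B\<close> contains some
  \<open>b\<close> in \<open>B\<close>, and the sets containing a given \<open>b\<close> weigh at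
  most \<open>l * hard_core E l W\<close>.\<close>

lemma hard_core_Diff_ge:
  assumes "finite W" "l \<ge> 0" "B \<subseteq> W"
  shows "hard_core E l W * (1 - l * card B) \<le> hard_core E l (W - B)"
proof -
  have fB: "finite B" using assms finite_subset by auto
  let ?C = "\<lambda>b. {I \<in> indep_sets E W. b \<in> I}"
  have "hard_core E l W \<le> (\<Sum>I\<in>indep_sets E (W - B) \<union> (\<Union>b\<in>B. ?C b). l ^ card I)"
    unfolding hard_core_def using assms fB
    by (intro sum_mono2) (auto simp: indep_sets_def intro: finite_subset)
  also have "\<dots> \<le> hard_core E l (W - B) + (\<Sum>I\<in>(\<Union>b\<in>B. ?C b). l ^ card I)"
    unfolding hard_core_def using assms fB
    by (subst sum.union_inter[symmetric]) (auto intro!: sum_nonneg)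
  also have "(\<Sum>I\<in>(\<Union>b\<in>B. ?C b). l ^ card I) \<le> (\<Sum>b\<in>B. \<Sum>I\<in>?C b. l ^ card I)"
    using assms fB by (intro sum_UN_le) auto
  also have "\<dots> \<le> (\<Sum>b\<in>B. l * hard_core E l W)"
  proof (rule sum_mono)
    fix b assume "b \<in> B"
    then have "b \<in> W" using assms by auto
    then show "(\<Sum>I\<in>?C b. l ^ card I) \<le> l * hard_core E l W"
      using assms by (auto simp: sum_indep_sets_containing intro!: mult_left_mono hard_core_mono)
  qed
  finally show ?thesis by (simp add: algebra_simps)
qed

text \<open>A vertex \<open>u\<close> is occupied with probability at least
  \<open>l * (1 - l * (deg u + 1))\<close>. Since \<open>a \<ge> 1\<close>, the average of
  \<open>deg u + 1\<close> is at most \<open>2 * a\<close>, so the choice of \<open>l\<close> loses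
  at most half of the main term.\<close>

lemma sum_indep_sets_card_ge:
  fixes a l :: real
  assumes fin: "finite W" and "a \<ge> 1"
    and deg: "(\<Sum>w\<in>W. real (card (nbrs E W w))) \<le> a * card W"
    and l: "l = 1 / (4 * a)"
  shows "(\<Sum>I\<in>indep_sets E W. l ^ card I * card I) \<ge> l * card W * hard_core E l W / 2"
proof -
  have l0: "l > 0" using assms by simp
  let ?Z = "hard_core E l W"
  have Z: "?Z \<ge> 1" using fin l0 by (intro hard_core_ge_1) auto
  have "(\<Sum>I\<in>indep_sets E W. l ^ card I * card I)
      = (\<Sum>I\<in>indep_sets E W. \<Sum>u\<in>W. if u \<in> I then l ^ card I else 0)"
  proof (rule sum.cong)
    fix I assume "I \<in> indep_sets E W"
    then have "W \<inter> I = I" by (auto simp: indep_sets_def)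
    then show "l ^ card I * card I = (\<Sum>u\<in>W. if u \<in> I then l ^ card I else 0)"
      using fin by (simp add: sum.If_cases)
  qed simp
  also have "\<dots> = (\<Sum>u\<in>W. \<Sum>I\<in>{I \<in> indep_sets E W. u \<in> I}. l ^ card I)"
    using fin by (subst sum.swap) (auto simp: sum.inter_filter)
  finally have card_eq: "(\<Sum>I\<in>indep_sets E W. l ^ card I * card I)
      = (\<Sum>u\<in>W. \<Sum>I\<in>{I \<in> indep_sets E W. u \<in> I}. l ^ card I)" .
  have "l * card W * ?Z / 2 = l * ?Z * (card W / 2)" by simp
  also have "\<dots> \<le> l * ?Z * (card W - l * ((\<Sum>u\<in>W. real (card (nbrs E W u))) + card W))"
  proof (rule mult_left_mono)
    have "l * ((\<Sum>u\<in>W. real (card (nbrs E W u))) + card W) \<le> l * (a * card W + a * card W)"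
      using deg l0 \<open>a \<ge> 1\<close> by (intro mult_left_mono add_mono) (auto simp: mult_le_cancel_right1)
    also have "\<dots> = card W / 2" using l \<open>a \<ge> 1\<close> by (simp add: field_simps)
    finally show "card W / 2 \<le> card W - l * ((\<Sum>u\<in>W. real (card (nbrs E W u))) + card W)"
      by simp
  qed (use l0 Z in auto)
  also have "\<dots> = (\<Sum>u\<in>W. l * (?Z * (1 - l * (card (nbrs E W u) + 1))))"
    by (simp add: sum_subtractf sum.distrib algebra_simps flip: sum_distrib_left)
  also have "\<dots> \<le> (\<Sum>u\<in>W. \<Sum>I\<in>{I \<in> indep_sets E W. u \<in> I}. l ^ card I)"
  proof (rule sum_mono)
    fix u assume u: "u \<in> W"
    have "card (insert u (nbrs E W u)) = card (nbrs E W u) + 1"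
      using fin irrefl by (auto simp: nbrs_def)
    then have "?Z * (1 - l * (card (nbrs E W u) + 1)) \<le> hard_core E l (W - insert u (nbrs E W u))"
      using hard_core_Diff_ge[of W l "insert u (nbrs E W u)"] fin l0 u by (auto simp: nbrs_def)
    then show "l * (?Z * (1 - l * (card (nbrs E W u) + 1)))
        \<le> (\<Sum>I\<in>{I \<in> indep_sets E W. u \<in> I}. l ^ card I)"
      using u fin l0 by (simp add: sum_indep_sets_containing)
  qed
  finally show ?thesis unfolding card_eq .
qed

text \<open>The inequality at one vertex after conditioning: the local part is \<open>{v}\<close>,
  of weight \<open>l\<close>, or an independent subset of \<open>W\<close>, so the total weight is
  \<open>l + hard_core E l W\<close>.\<close>

lemma local_occupancy:
  fixes a l D :: real
  assumes fin: "finite W" and a: "a \<ge> 1"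
    and deg: "(\<Sum>w\<in>W. real (card (nbrs E W w))) \<le> a * card W"
    and l: "l = 1 / (4 * a)" and D: "D * l \<ge> 1"
  shows "ln (D * l) / 8 * (l + hard_core E l W)
       \<le> D * l + (\<Sum>I\<in>indep_sets E W. l ^ card I * card I)"
proof -
  let ?Z = "hard_core E l W" and ?g = "ln (D * l) / 8" and ?x = "l * card W"
  have l0: "l > 0" "l \<le> 1" using l a by auto
  have Z: "?Z \<ge> 1" using fin l0 by (intro hard_core_ge_1) auto
  have g: "?g \<ge> 0" using D by simp
  have occ: "?x * ?Z / 2 \<le> (\<Sum>I\<in>indep_sets E W. l ^ card I * card I)"
    using sum_indep_sets_card_ge[OF fin a deg l] by simp
  have "?g * (l + ?Z) \<le> ?g * (2 * ?Z)"
    using g Z l0 by (intro mult_left_mono) auto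
  also have "\<dots> \<le> D * l + ?x * ?Z / 2"
  \<comment> \<open>The threshold \<open>4 * ?g\<close> is \<open>ln (sqrt (D * l))\<close>. Above
    it the term \<open>?x * ?Z / 2\<close> suffices; below it both \<open>?Z\<close> and
    \<open>4 * ?g\<close> are at most \<open>sqrt (D * l)\<close>, and the term \<open>D * l\<close>
    suffices.\<close>
  proof (cases "?x \<ge> 4 * ?g")
    case True
    then have "4 * ?g * ?Z \<le> ?x * ?Z" using Z by (intro mult_right_mono) auto
    then show ?thesis using D by linarith
  next
    case False
    have s: "sqrt (D * l) > 0" using D by (metis real_sqrt_gt_zero zero_less_one order_less_le_trans)
    have "ln (D * l) = 2 * ln (sqrt (D * l))"
      using D by (simp add: ln_sqrt)
    also have "\<dots> \<le> 2 * sqrt (D * l)"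
      using ln_less_self[OF s] by linarith
    finally have ln: "ln (D * l) \<le> 2 * sqrt (D * l)" .
    have "?Z \<le> exp ?x" using fin l0 by (intro hard_core_le_exp) auto
    also have "\<dots> \<le> exp (ln (sqrt (D * l)))" using False D by (simp add: ln_sqrt)
    finally have "?Z \<le> sqrt (D * l)" using s by simp
    then have "?g * (2 * ?Z) \<le> (2 * sqrt (D * l) / 8) * (2 * sqrt (D * l))"
      using ln Z s by (intro mult_mono) auto
    also have "\<dots> = D * l / 2" using D by simp
    also have "\<dots> \<le> D * l" using D by simp
    finally show ?thesis using l0 Z by (smt (verit) divide_nonneg_nonneg mult_nonneg_nonneg of_nat_0_le_iff)
  qed
  finally show ?thesis using occ by linarith
qed

text \<open>An independent set \<open>I\<close> is split into its part \<open>J\<close> outside the closed neighbourhood of \<open>v\<close> and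
  its part inside, which is either \<open>{v}\<close> or an independent subset of \<open>W J\<close>.\<close>

lemma sum_indep_sets_split:
  fixes l :: real and h :: "'a set \<Rightarrow> real"
  assumes "finite V" "v \<in> V"
  defines "N \<equiv> nbrs E V v"
  defines "W \<equiv> \<lambda>J. {u \<in> N. \<forall>x\<in>J. \<not> E u x}"
  shows "(\<Sum>I\<in>indep_sets E V. l ^ card I * h (I \<inter> insert v N))
       = (\<Sum>J\<in>indep_sets E (V - insert v N).
            l ^ card J * (l * h {v} + (\<Sum>K\<in>indep_sets E (W J). l ^ card K * h K)))"
proof -
  let ?A = "indep_sets E (V - insert v N)"
  \<comment> \<open>\<open>{v}\<close> is possible for every \<open>J\<close>, because
    \<open>J\<close> contains no neighbour of \<open>v\<close>; it is not a subset of
    \<open>W J\<close>, so it contributes a separate term.\<close>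
  let ?B = "\<lambda>J. insert {v} (indep_sets E (W J))"
  have vN: "v \<notin> N" "N \<subseteq> V" using irrefl by (auto simp: N_def nbrs_def)
  have WN: "W J \<subseteq> N" for J by (auto simp: W_def)
  have fin: "finite N" "finite (W J)" for J
    using vN WN assms(1) finite_subset by metis+
  have "(\<Sum>I\<in>indep_sets E V. l ^ card I * h (I \<inter> insert v N))
      = (\<Sum>(J,K)\<in>Sigma ?A ?B. l ^ card J * (l ^ card K * h K))"
  proof (rule sum.reindex_bij_witness[of _ "\<lambda>(J,K). J \<union> K" "\<lambda>I. (I - insert v N, I \<inter> insert v N)"])
    fix I assume I: "I \<in> indep_sets E V"
    show "(case (I - insert v N, I \<inter> insert v N) of (J,K) \<Rightarrow> J \<union> K) = I" by auto
    show "(I - insert v N, I \<inter> insert v N) \<in> Sigma ?A ?B"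
    proof (cases "v \<in> I")
      case True
      then have "I \<inter> insert v N = {v}"
        using I by (auto simp: indep_sets_def N_def nbrs_def)
      then show ?thesis using I by (auto simp: indep_sets_def)
    next
      case False
      then show ?thesis using I by (auto simp: indep_sets_def W_def)
    qed
    have "finite I" using I assms(1) finite_of_indep_sets by auto
    then have "card I = card (I - insert v N) + card (I \<inter> insert v N)"
      by (metis card_Diff_subset_Int card_mono diff_add finite_Int inf_le1)
    then show "(case (I - insert v N, I \<inter> insert v N) of
        (J,K) \<Rightarrow> l ^ card J * (l ^ card K * h K)) = l ^ card I * h (I \<inter> insert v N)"
      by (simp add: power_add)
  next
    fix p assume p: "p \<in> Sigma ?A ?B"
    obtain J K where JK: "p = (J,K)" "J \<in> ?A" "K \<in> ?B J" using p by auto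
    have K: "K \<subseteq> insert v N" using JK(3) WN[of J] by (auto simp: indep_sets_def)
    have J: "J \<inter> insert v N = {}" "J \<subseteq> V" using JK by (auto simp: indep_sets_def)
    show "((case p of (J,K) \<Rightarrow> J \<union> K) - insert v N, (case p of (J,K) \<Rightarrow> J \<union> K) \<inter> insert v N) = p"
      using JK(1) J K by auto
    have cross: "\<not> E x y" if "x \<in> K" "y \<in> J" for x y
    proof (cases "x = v")
      case True
      then show ?thesis using that J by (auto simp: N_def nbrs_def)
    next
      case False
      then have "x \<in> W J" using JK that by (auto simp: indep_sets_def)
      then show ?thesis using that by (auto simp: W_def)
    qed
    have "\<forall>u\<in>K. \<forall>w\<in>K. \<not> E u w" using JK irrefl by (auto simp: indep_sets_def)
    moreover have "\<forall>u\<in>J. \<forall>w\<in>J. \<not> E u w" using JK by (auto simp: indep_sets_def)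
    ultimately show "(case p of (J,K) \<Rightarrow> J \<union> K) \<in> indep_sets E V"
      using JK(1) J K vN assms(2) cross by (auto simp: indep_sets_def dest: sym)
  qed
  also have "\<dots> = (\<Sum>J\<in>?A. \<Sum>K\<in>?B J. l ^ card J * (l ^ card K * h K))"
    using assms(1) fin by (subst sum.Sigma) auto
  also have "\<dots> = (\<Sum>J\<in>?A. l ^ card J * (\<Sum>K\<in>?B J. l ^ card K * h K))"
    by (simp only: sum_distrib_left)
  also have "\<dots> = (\<Sum>J\<in>?A. l ^ card J * (l * h {v} + (\<Sum>K\<in>indep_sets E (W J). l ^ card K * h K)))"
  proof -
    have "{v} \<notin> indep_sets E (W J)" for J using WN[of J] vN by (auto simp: indep_sets_def)
    then show ?thesis using fin by simp
  qed
  finally show ?thesis .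
qed

section \<open>Large independent sets in locally sparse graphs\<close>

theorem independent_set_locally_sparse:
  fixes a D :: real
  assumes fin: "finite V" and a: "a \<ge> 1" and D: "D \<ge> 4 * a"
    and deg: "\<And>v. v \<in> V \<Longrightarrow> card (nbrs E V v) \<le> D"
    and sparse: "\<And>v W. v \<in> V \<Longrightarrow> W \<subseteq> nbrs E V v \<Longrightarrow>
           (\<Sum>w\<in>W. real (card (nbrs E W w))) \<le> a * card W"
  shows "\<exists>I\<in>indep_sets E V. card I \<ge> card V * ln (D / (4 * a)) / (16 * D)"
proof (rule ccontr)
  assume neg: "\<not> ?thesis"
  define l where "l = 1 / (4 * a)"
  define g where "g = ln (D * l) / 8"
  have l0: "l > 0" using a l_def by auto
  have Dl: "D * l \<ge> 1" using a D by (simp add: l_def)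
  have D0: "D > 0" using a D by linarith
  \<comment> \<open>The average of \<open>?f v\<close> is the left-hand side of the local inequality
    at \<open>v\<close>: \<open>D\<close> times the occupation of \<open>v\<close> plus the number
    of occupied neighbours.\<close>
  let ?f = "\<lambda>v I. D * (if v \<in> I then 1 else 0) + real (card (I \<inter> nbrs E V v))"
  have vertex: "g * hard_core E l V \<le> (\<Sum>I\<in>indep_sets E V. l ^ card I * ?f v I)" if v: "v \<in> V" for v
  proof -
    define N where "N = nbrs E V v"
    define W where "W = (\<lambda>J. {u \<in> N. \<forall>x\<in>J. \<not> E u x})"
    have vN: "v \<notin> N" using irrefl by (auto simp: N_def nbrs_def)
    have WN: "W J \<subseteq> N" for J by (auto simp: W_def)
    have finW: "finite (W J)" for J
      using WN[of J] fin finite_subset unfolding N_def by (metis finite_nbrs)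
    let ?A = "indep_sets E (V - insert v N)"
    have "g * hard_core E l V = (\<Sum>I\<in>indep_sets E V. l ^ card I * g)"
      by (simp add: hard_core_def sum_distrib_right[symmetric])
    also have "\<dots> = (\<Sum>J\<in>?A. l ^ card J * (l * g + (\<Sum>K\<in>indep_sets E (W J). l ^ card K * g)))"
      using sum_indep_sets_split[OF fin v, of l "\<lambda>_. g"] unfolding N_def W_def by simp
    also have "\<dots> \<le> (\<Sum>J\<in>?A. l ^ card J * (l * ?f v {v} + (\<Sum>K\<in>indep_sets E (W J). l ^ card K * ?f v K)))"
    proof (intro sum_mono mult_left_mono)
      fix J
      have f: "?f v {v} = D" using vN N_def by simp
      have f2: "?f v K = card K" if "K \<in> indep_sets E (W J)" for K
      proof -
        have "K \<subseteq> N" using that WN by (auto simp: indep_sets_def)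
        then show ?thesis using vN by (auto simp: N_def Int_absorb2)
      qed
      have "g * (l + hard_core E l (W J)) \<le> D * l + (\<Sum>I\<in>indep_sets E (W J). l ^ card I * card I)"
        unfolding g_def using sparse[OF v, of "W J"] WN[of J]
        by (intro local_occupancy[where a=a] finW a l_def Dl) (auto simp: N_def)
      then show "l * g + (\<Sum>K\<in>indep_sets E (W J). l ^ card K * g)
          \<le> l * ?f v {v} + (\<Sum>K\<in>indep_sets E (W J). l ^ card K * ?f v K)"
        unfolding f using f2
        by (simp add: hard_core_def sum_distrib_left algebra_simps)
    qed (use l0 in auto)
    also have "\<dots> = (\<Sum>I\<in>indep_sets E V. l ^ card I * ?f v (I \<inter> insert v N))"
      using sum_indep_sets_split[OF fin v, of l "?f v"] unfolding N_def W_def by simp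
    \<comment> \<open>\<open>?f v\<close> depends only on the part of \<open>I\<close> in the closed
      neighbourhood of \<open>v\<close>.\<close>
    also have "\<dots> = (\<Sum>I\<in>indep_sets E V. l ^ card I * ?f v I)"
    proof (rule sum.cong)
      fix I
      have "I \<inter> insert v N \<inter> N = I \<inter> N" by auto
      then show "l ^ card I * ?f v (I \<inter> insert v N) = l ^ card I * ?f v I"
        by (simp add: N_def)
    qed simp
    finally show ?thesis .
  qed
  \<comment> \<open>Double counting: each \<open>u\<close> in \<open>I\<close> contributes
    \<open>D\<close> as a vertex and at most \<open>D\<close> as a neighbour of others.\<close>
  have total: "(\<Sum>v\<in>V. ?f v I) \<le> 2 * D * card I" if I: "I \<in> indep_sets E V" for I
  proof -
    have IV: "I \<subseteq> V" "V \<inter> I = I" using I by (auto simp: indep_sets_def)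
    have fI: "finite I" using I fin finite_of_indep_sets by auto
    have "(\<Sum>v\<in>V. real (card (I \<inter> nbrs E V v))) = (\<Sum>v\<in>V. \<Sum>u\<in>I. if E v u then 1 else 0)"
    proof (rule sum.cong)
      fix v
      have "I \<inter> nbrs E V v = I \<inter> {u. E v u}" using IV by (auto simp: nbrs_def)
      then show "real (card (I \<inter> nbrs E V v)) = (\<Sum>u\<in>I. if E v u then 1 else 0)"
        using fI by (simp add: sum.If_cases)
    qed simp
    also have "\<dots> = (\<Sum>u\<in>I. \<Sum>v\<in>V. if E v u then 1 else 0)" by (rule sum.swap)
    also have "\<dots> = (\<Sum>u\<in>I. real (card (nbrs E V u)))"
    proof (rule sum.cong)
      fix u
      have "nbrs E V u = V \<inter> {v. E v u}" using sym by (auto simp: nbrs_def)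
      then show "(\<Sum>v\<in>V. if E v u then 1 else 0) = real (card (nbrs E V u))"
        using fin by (simp add: sum.If_cases)
    qed simp
    also have "\<dots> \<le> (\<Sum>u\<in>I. D)" using IV deg by (intro sum_mono) auto
    finally have "(\<Sum>v\<in>V. real (card (I \<inter> nbrs E V v))) \<le> D * card I" by (simp add: mult.commute)
    moreover have "(\<Sum>v\<in>V. D * (if v \<in> I then 1 else 0)) = D * card I"
      using fin IV by (simp add: sum_distrib_left[symmetric] sum.If_cases)
    ultimately show ?thesis by (simp add: sum.distrib)
  qed
  have "card V * g * hard_core E l V = (\<Sum>v\<in>V. g * hard_core E l V)" by simp
  also have "\<dots> \<le> (\<Sum>v\<in>V. \<Sum>I\<in>indep_sets E V. l ^ card I * ?f v I)"
    by (intro sum_mono vertex)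
  also have "\<dots> = (\<Sum>I\<in>indep_sets E V. l ^ card I * (\<Sum>v\<in>V. ?f v I))"
    by (subst sum.swap) (simp only: sum_distrib_left)
  also have "\<dots> \<le> (\<Sum>I\<in>indep_sets E V. l ^ card I * (2 * D * card I))"
    using l0 by (intro sum_mono mult_left_mono total) auto
  \<comment> \<open>If every independent set were below the claimed size, so would be the weighted
    average. Strictness uses positive weights and the presence of the empty set.\<close>
  also have "\<dots> < (\<Sum>I\<in>indep_sets E V. l ^ card I * (card V * g))"
  proof (rule sum_strict_mono)
    fix I assume "I \<in> indep_sets E V"
    then have "card I < card V * ln (D / (4 * a)) / (16 * D)" using neg by force
    also have "\<dots> = card V * g / (2 * D)" by (simp add: g_def l_def)
    finally have "2 * D * card I < card V * g" using D0 by (simp add: field_simps)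
    then show "l ^ card I * (2 * D * card I) < l ^ card I * (card V * g)" using l0 by simp
  qed (use fin empty_in_indep_sets[of E V] in \<open>auto simp del: empty_in_indep_sets\<close>)
  also have "\<dots> = card V * g * hard_core E l V"
    by (simp add: hard_core_def sum_distrib_right[symmetric])
  finally show False by simp
qed

section \<open>Edge bound from small codegrees\<close>

text \<open>The Kovari-Sos-Turan argument: the sum of the squared degrees counts triples
  \<open>(w, u, v)\<close> with \<open>w\<close> adjacent to both \<open>u\<close> and
  \<open>v\<close>, and codegrees bound it from above.\<close>

lemma sum_degrees_le:
  fixes t :: nat
  assumes fin: "finite W" and t: "t \<ge> 1"
    and codeg: "\<And>u v. u \<in> W \<Longrightarrow> v \<in> W \<Longrightarrow> u \<noteq> v \<Longrightarrow> card (nbrs E W u \<inter> nbrs E W v) \<le> t"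
  shows "(\<Sum>w\<in>W. real (card (nbrs E W w))) \<le> 2 * card W * sqrt (t * card W)"
proof (cases "W = {}")
  case False
  define n where "n = real (card W)"
  have n: "n \<ge> 1" using False fin by (simp add: n_def Suc_leI card_gt_0_iff)
  \<comment> \<open>The claimed bound on the average degree.\<close>
  define b where "b = 2 * sqrt (t * n)"
  have "1 * 1 \<le> real t * n" using n t by (intro mult_mono) auto
  then have b: "b \<ge> 2" by (simp add: b_def)
  have b2: "b\<^sup>2 = 4 * (t * n)" using n by (simp add: b_def power_mult_distrib)
  define e :: "'a \<Rightarrow> 'a \<Rightarrow> real" where "e = (\<lambda>u v. if E u v then 1 else 0)"
  define d where "d = (\<lambda>w. real (card (nbrs E W w)))"
  let ?S = "\<Sum>w\<in>W. d w"
  have e_sym: "e u v = e v u" for u v using sym by (auto simp: e_def)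
  have d_e: "d w = (\<Sum>u\<in>W. e w u)" for w
  proof -
    have "nbrs E W w = W \<inter> {u. E w u}" by (auto simp: nbrs_def)
    then show ?thesis using fin by (simp add: d_def e_def sum.If_cases)
  qed
  have codeg_e: "real (card (nbrs E W u \<inter> nbrs E W v)) = (\<Sum>w\<in>W. e w u * e w v)" for u v
  proof -
    have "nbrs E W u \<inter> nbrs E W v = W \<inter> {w. E w u \<and> E w v}"
      using sym by (auto simp: nbrs_def)
    moreover have "e w u * e w v = (if E w u \<and> E w v then 1 else 0)" for w by (simp add: e_def)
    ultimately show ?thesis using fin by (simp add: sum.If_cases)
  qed
  have "(\<Sum>w\<in>W. (d w)\<^sup>2) = (\<Sum>w\<in>W. \<Sum>u\<in>W. \<Sum>v\<in>W. e w u * e w v)"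
    by (simp add: d_e power2_eq_square sum_product)
  also have "\<dots> = (\<Sum>u\<in>W. \<Sum>v\<in>W. \<Sum>w\<in>W. e w u * e w v)"
    by (subst sum.swap) (intro sum.cong refl sum.swap)
  also have "\<dots> = (\<Sum>u\<in>W. \<Sum>v\<in>W. real (card (nbrs E W u \<inter> nbrs E W v)))"
    by (simp add: codeg_e)
  \<comment> \<open>The diagonal \<open>u = v\<close> gives the degree itself; all other pairs have
    codegree at most \<open>t\<close>.\<close>
  also have "\<dots> \<le> (\<Sum>u\<in>W. \<Sum>v\<in>W. (if v = u then d u else 0) + t)"
  proof (intro sum_mono)
    fix u v assume "u \<in> W" "v \<in> W"
    then show "real (card (nbrs E W u \<inter> nbrs E W v)) \<le> (if v = u then d u else 0) + t"
      using codeg[of u v] by (auto simp: d_def)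
  qed
  also have "\<dots> = ?S + n * b\<^sup>2 / 4"
    using fin by (simp add: sum.distrib b2 n_def)
  finally have upper: "(\<Sum>w\<in>W. (d w)\<^sup>2) \<le> ?S + n * b\<^sup>2 / 4" .
  txt \<open>Linearizing the square at \<open>b\<close> replaces the Cauchy--Schwarz inequality.\<close>
  have "(\<Sum>w\<in>W. 2 * b * d w - b\<^sup>2) \<le> (\<Sum>w\<in>W. (d w)\<^sup>2)"
  proof (rule sum_mono)
    fix w
    have "0 \<le> (d w - b)\<^sup>2" by simp
    then show "2 * b * d w - b\<^sup>2 \<le> (d w)\<^sup>2" by (simp add: power2_eq_square algebra_simps)
  qed
  then have "(2 * b - 1) * ?S \<le> 5 / 4 * n * b\<^sup>2"
    using upper by (simp add: sum_subtractf flip: sum_distrib_left n_def) (simp add: algebra_simps)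
  \<comment> \<open>The diagonal term is absorbed here: \<open>5 / 4 * b \<le> 2 * b - 1\<close>
    follows from \<open>b \<ge> 2\<close>.\<close>
  also have "\<dots> \<le> (2 * b - 1) * (n * b)"
  proof -
    have "5 / 4 * b * (n * b) \<le> (2 * b - 1) * (n * b)"
      using b n by (intro mult_right_mono) auto
    then show ?thesis by (simp add: power2_eq_square algebra_simps)
  qed
  finally have "?S \<le> n * b" using b by simp
  then show ?thesis by (simp add: d_def n_def b_def algebra_simps)
qed simp

end

section \<open>Independent sets in a union of \<open>k\<close> graphs with small codegrees\<close>

text \<open>Codegrees are controlled only within each colour, so edges are bounded colour by colour,
  at the cost of a factor \<open>k\<close>. In terms of \<open>q\<close>, the ratio
  \<open>n / D\<close> is \<open>q / (4 * k)\<close>, and \<open>q \<ge> 16 * k\<close> amounts to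
  \<open>D \<ge> 4 * a\<close>.\<close>

theorem independent_set_of_union:
  fixes A :: "nat \<Rightarrow> 'a \<Rightarrow> 'a \<Rightarrow> bool" and k t :: nat and q :: real
  assumes fin: "finite V" and k: "k \<ge> 1" and t: "t \<ge> 1"
    and adj: "\<And>i. simple_adj (A i)"
    and codeg: "\<And>i u v. i < k \<Longrightarrow> u \<in> V \<Longrightarrow> v \<in> V \<Longrightarrow> u \<noteq> v \<Longrightarrow>
           card (nbrs (A i) V u \<inter> nbrs (A i) V v) \<le> t"
    and q: "q = sqrt (card V / t)" "q \<ge> 16 * k"
  shows "\<exists>I\<in>indep_sets (\<lambda>u v. \<exists>i<k. A i u v) V. card I \<ge> q * ln (q / (16 * k)) / (256 * k)"
proof -
  define E where "E = (\<lambda>u v. \<exists>i<k. A i u v)"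
  interpret simple_adj E
    using adj by (auto simp: E_def simple_adj_def)
  have sum_deg: "(\<Sum>w\<in>W. real (card (nbrs E W w))) \<le> 2 * k * sqrt (t * card W) * card W"
    if WV: "W \<subseteq> V" for W
  proof -
    have fW: "finite W" using WV fin finite_subset by auto
    have "(\<Sum>w\<in>W. real (card (nbrs E W w))) \<le> (\<Sum>w\<in>W. \<Sum>i<k. real (card (nbrs (A i) W w)))"
    proof (rule sum_mono)
      fix w
      have "nbrs E W w = (\<Union>i<k. nbrs (A i) W w)" by (auto simp: nbrs_def E_def)
      then have "card (nbrs E W w) \<le> (\<Sum>i<k. card (nbrs (A i) W w))"
        using card_UN_le[of "{..<k}"] by simp
      then show "real (card (nbrs E W w)) \<le> (\<Sum>i<k. real (card (nbrs (A i) W w)))"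
        by (metis of_nat_le_iff of_nat_sum)
    qed
    also have "\<dots> = (\<Sum>i<k. \<Sum>w\<in>W. real (card (nbrs (A i) W w)))" by (rule sum.swap)
    also have "\<dots> \<le> (\<Sum>i<k. 2 * card W * sqrt (t * card W))"
    proof (rule sum_mono)
      fix i assume i: "i \<in> {..<k}"
      show "(\<Sum>w\<in>W. real (card (nbrs (A i) W w))) \<le> 2 * card W * sqrt (t * card W)"
      proof (rule simple_adj.sum_degrees_le[OF adj fW t])
        fix u v assume uv: "u \<in> W" "v \<in> W" "u \<noteq> v"
        have "card (nbrs (A i) W u \<inter> nbrs (A i) W v) \<le> card (nbrs (A i) V u \<inter> nbrs (A i) V v)"
          using WV fin by (intro card_mono) (auto simp: nbrs_def)
        also have "\<dots> \<le> t" using codeg uv WV i by blast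
        finally show "card (nbrs (A i) W u \<inter> nbrs (A i) W v) \<le> t" .
      qed
    qed
    finally show ?thesis by (simp add: algebra_simps)
  qed
  define n where "n = real (card V)"
  \<comment> \<open>\<open>D\<close> is twice the bound on the average degree of the whole graph;
    \<open>a\<close> is the same kind of bound for sets of at most \<open>D\<close>
    vertices.\<close>
  define D where "D = 4 * k * sqrt (t * n)"
  define a where "a = 2 * k * sqrt (t * D)"
  have q0: "q > 0" using q k by linarith
  then have n0: "n > 0" unfolding n_def using q by (cases "card V = 0") auto
  then have n1: "n \<ge> 1" by (simp add: n_def Suc_leI)
  have "1 * 1 \<le> real t * n" using n1 t by (intro mult_mono) auto
  then have D4: "1 * 1 \<le> 4 * real k * sqrt (t * n)" using k by (intro mult_mono) auto
  then have D1: "D \<ge> 1" by (simp add: D_def)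
  have "1 * 1 \<le> real t * D" using D1 t by (intro mult_mono) auto
  then have "1 * 1 \<le> 2 * real k * sqrt (t * D)" using k by (intro mult_mono) auto
  then have a1: "a \<ge> 1" by (simp add: a_def)
  have Dq: "D = 4 * k * t * q"
    using t by (simp add: D_def q n_def real_sqrt_divide real_sqrt_mult real_div_sqrt field_simps)
  have nq: "n = t * q\<^sup>2" using t by (simp add: q n_def)
  have D4a: "D / (4 * a) = sqrt (q / (16 * k))"
  proof (rule real_sqrt_unique[symmetric])
    have "a\<^sup>2 = 4 * real k ^ 2 * (t * D)" using D1 by (simp add: a_def power_mult_distrib)
    then have "(D / (4 * a))\<^sup>2 = D\<^sup>2 / (64 * real k ^ 2 * t * D)"
      by (simp add: power_divide power_mult_distrib)
    also have "\<dots> = D / (64 * real k ^ 2 * t)" using D1 by (simp add: power2_eq_square)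
    also have "\<dots> = q / (16 * k)" using k t by (simp add: Dq power2_eq_square field_simps)
    finally show "(D / (4 * a))\<^sup>2 = q / (16 * k)" .
  qed (use D1 a1 in auto)
  have "q / (16 * k) \<ge> 1" using q k by simp
  then have "D / (4 * a) \<ge> 1" by (simp add: D4a)
  then have Da: "D \<ge> 4 * a" using a1 by (simp add: field_simps)
  define U where "U = {v \<in> V. card (nbrs E V v) \<le> D}"
  have UV: "U \<subseteq> V" "finite U" using fin by (auto simp: U_def)
  \<comment> \<open>Markov's inequality: at most half of the vertices have degree above
    \<open>D\<close>.\<close>
  have "D * (n - card U) = (\<Sum>v\<in>V - U. D)"
    using UV fin by (simp add: card_Diff_subset of_nat_diff card_mono n_def)
  also have "\<dots> \<le> (\<Sum>v\<in>V - U. real (card (nbrs E V v)))"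
    by (intro sum_mono) (auto simp: U_def)
  also have "\<dots> \<le> (\<Sum>v\<in>V. real (card (nbrs E V v)))"
    using fin by (intro sum_mono2) auto
  also have "\<dots> \<le> D * (n / 2)" using sum_deg[of V] by (simp add: D_def n_def mult_ac)
  finally have Un: "card U \<ge> n / 2" using D1 by simp
  have "\<exists>I\<in>indep_sets E U. card I \<ge> card U * ln (D / (4 * a)) / (16 * D)"
  proof (rule independent_set_locally_sparse[OF UV(2) a1 Da])
    show deg: "card (nbrs E U v) \<le> D" if "v \<in> U" for v
    proof -
      have "card (nbrs E U v) \<le> card (nbrs E V v)"
        using UV fin by (intro card_mono) (auto simp: nbrs_def)
      then show ?thesis using that by (auto simp: U_def)
    qed
    fix v W assume v: "v \<in> U" and W: "W \<subseteq> nbrs E U v"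
    have "card W \<le> card (nbrs E U v)" using W UV by (intro card_mono) auto
    then have "card W \<le> D" using deg[OF v] by linarith
    then have "2 * k * sqrt (t * card W) * card W \<le> a * card W"
      unfolding a_def by (intro mult_right_mono mult_left_mono real_sqrt_le_mono) (auto intro: mult_left_mono)
    moreover have "W \<subseteq> V" using W UV by (auto simp: nbrs_def)
    ultimately show "(\<Sum>w\<in>W. real (card (nbrs E W w))) \<le> a * card W"
      using sum_deg order_trans by blast
  qed
  then obtain I where I: "I \<in> indep_sets E U" "card I \<ge> card U * ln (D / (4 * a)) / (16 * D)"
    by auto
  have "ln (D / (4 * a)) = ln (q / (16 * k)) / 2"
    using q0 k by (simp add: D4a ln_sqrt)
  moreover have "ln (q / (16 * k)) \<ge> 0" using \<open>q / (16 * k) \<ge> 1\<close> by simp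
  ultimately have "n / 2 * (ln (q / (16 * k)) / 2) / (16 * D) \<le> card U * ln (D / (4 * a)) / (16 * D)"
    using Un D1 by (intro divide_right_mono mult_mono) auto
  \<comment> \<open>The factor 256 is 2 for the discarded vertices, 2 for the square root inside the
    logarithm, 16 from the sparse bound and 4 from \<open>D\<close>.\<close>
  moreover have "n / 2 * (ln (q / (16 * k)) / 2) / (16 * D) = q * ln (q / (16 * k)) / (256 * k)"
    unfolding nq Dq using q0 t k by (simp add: power2_eq_square field_simps)
  ultimately have "card I \<ge> q * ln (q / (16 * k)) / (256 * k)" using I by linarith
  moreover have "I \<in> indep_sets E V" using I UV by (auto simp: indep_sets_def)
  ultimately show ?thesis unfolding E_def by blast
qed

section \<open>From edge colourings to graphs\<close>

text \<open>The part of size 2 goes to \<open>u\<close> and \<open>v\<close>, the other part to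
  \<open>t\<close> common neighbours. The conditions \<open>w \<noteq> u\<close> and
  \<open>w \<noteq> v\<close> exclude singletons, which are not edges.\<close>

lemma contains_copy_bipartite:
  assumes "u \<noteq> v" "u < r" "v < r"
    and "card {w. w < r \<and> w \<noteq> u \<and> w \<noteq> v \<and> col {u, w} = i \<and> col {v, w} = i} \<ge> t"
  shows "contains_copy (colour_class (complete_graph r) col i) (complete_bipartite 2 t)"
proof -
  let ?C = "{w. w < r \<and> w \<noteq> u \<and> w \<noteq> v \<and> col {u, w} = i \<and> col {v, w} = i}"
  obtain T where T: "T \<subseteq> ?C" "card T = t" "finite T"
    using obtain_subset_with_card_n[OF assms(4)] by auto
  obtain g where g: "bij_betw g {..<t} T"
    using ex_bij_betw_nat_finite[OF T(3)] T(2) by (auto simp: atLeast0LessThan)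
  have gT: "g j \<in> ?C" if "j < t" for j
    using g that T by (meson bij_betwE lessThan_iff subsetD)
  have ginj: "g i = g j \<longleftrightarrow> i = j" if "i < t" "j < t" for i j
    using g that by (metis bij_betw_def inj_on_eq_iff lessThan_iff)
  let ?f = "case_sum (\<lambda>i::nat. if i = 0 then u else v) g"
  have f_inj: "inj_on ?f ({..<2} <+> {..<t})"
  proof (rule inj_onI)
    fix x y assume "x \<in> {..<2} <+> {..<t}" "y \<in> {..<2} <+> {..<t}" "?f x = ?f y"
    then show "x = y"
      using assms gT ginj by (cases x; cases y) (auto split: if_splits)
  qed
  have f_img: "?f ` ({..<2} <+> {..<t}) \<subseteq> {..<r}"
    using assms gT by auto
  have "{?f (Inl a), ?f (Inr j)} \<in> {e \<in> nsets {..<r} 2. col e = i}" if "j < t" for a j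
    using assms(2,3) gT[OF that] by (auto simp: nsets_def)
  then show ?thesis
    unfolding contains_copy_def colour_class_def complete_graph_def complete_bipartite_def
    using f_inj f_img by (intro exI[of _ ?f]) auto
qed

lemma contains_copy_complete:
  assumes "I \<subseteq> {..<r}" "card I \<ge> m"
    and "\<And>u v. u \<in> I \<Longrightarrow> v \<in> I \<Longrightarrow> u \<noteq> v \<Longrightarrow> col {u, v} = i"
  shows "contains_copy (colour_class (complete_graph r) col i) (complete_graph m)"
proof -
  obtain T where T: "T \<subseteq> I" "card T = m" "finite T"
    using obtain_subset_with_card_n[OF assms(2)] by auto
  obtain g where g: "bij_betw g {..<m} T"
    using ex_bij_betw_nat_finite[OF T(3)] T(2) by (auto simp: atLeast0LessThan)
  have gI: "g ` {..<m} \<subseteq> I" and ginj: "inj_on g {..<m}"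
    using g T by (auto simp: bij_betw_def)
  have "g ` e \<in> {e \<in> nsets {..<r} 2. col e = i}" if e: "e \<in> nsets {..<m} 2" for e
  proof -
    obtain x y where xy: "e = {x, y}" "x \<noteq> y" "x < m" "y < m"
      using e by (auto elim: nsets2_E)
    then have "g x \<noteq> g y" "g x \<in> I" "g y \<in> I"
      using gI ginj by (auto simp: inj_on_def)
    then show ?thesis using xy assms by (auto simp: nsets_def)
  qed
  then show ?thesis
    unfolding contains_copy_def colour_class_def complete_graph_def
    using gI ginj assms(1) by (intro exI[of _ g]) auto
qed

lemma ramsey_prop_of_large:
  fixes k t m r :: nat and q :: real
  assumes k: "k \<ge> 1" and t: "t \<ge> 1"
    and q: "q = sqrt (r / t)" "q \<ge> 16 * k" "q * ln (q / (16 * k)) / (256 * k) \<ge> m"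
  shows "ramsey_prop k (complete_bipartite 2 t) (complete_graph m) r"
  unfolding ramsey_prop_def
proof (intro ballI)
  fix col assume col: "col \<in> edges (complete_graph r) \<rightarrow> {..<k + 1}"
  define A where "A = (\<lambda>i u v. u < r \<and> v < r \<and> u \<noteq> v \<and> col {u, v} = i)"
  show "(\<exists>i<k. contains_copy (colour_class (complete_graph r) col i) (complete_bipartite 2 t)) \<or>
        contains_copy (colour_class (complete_graph r) col k) (complete_graph m)"
  proof (cases "\<exists>i<k. contains_copy (colour_class (complete_graph r) col i) (complete_bipartite 2 t)")
    case no: False
    have adj: "simple_adj (A i)" for i
      by unfold_locales (auto simp: A_def insert_commute)
    have codeg: "card (nbrs (A i) {..<r} u \<inter> nbrs (A i) {..<r} v) \<le> t"
      if "i < k" "u \<in> {..<r}" "v \<in> {..<r}" "u \<noteq> v" for i u v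
    proof -
      have "nbrs (A i) {..<r} u \<inter> nbrs (A i) {..<r} v
          = {w. w < r \<and> w \<noteq> u \<and> w \<noteq> v \<and> col {u, w} = i \<and> col {v, w} = i}"
        using that by (auto simp: nbrs_def A_def)
      then show ?thesis
        using contains_copy_bipartite[of u v r t col i] no that by fastforce
    qed
    obtain I where I: "I \<in> indep_sets (\<lambda>u v. \<exists>i<k. A i u v) {..<r}"
        "card I \<ge> q * ln (q / (16 * k)) / (256 * k)"
      using independent_set_of_union[of "{..<r}" k t A q] k t adj codeg q(1,2) by auto
    have "contains_copy (colour_class (complete_graph r) col k) (complete_graph m)"
    proof (rule contains_copy_complete)
      show "I \<subseteq> {..<r}" using I by (auto simp: indep_sets_def)
      show "m \<le> card I" using I q by linarith
      fix u v assume uv: "u \<in> I" "v \<in> I" "u \<noteq> v"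
      then have lt: "u < r" "v < r" using I by (auto simp: indep_sets_def)
      then have "{u, v} \<in> edges (complete_graph r)"
        using uv by (auto simp: complete_graph_def nsets_def)
      then have "col {u, v} < k + 1" using col by auto
      \<comment> \<open>Independence in the union rules out the first \<open>k\<close> colours,
        which leaves only colour \<open>k\<close>.\<close>
      moreover have "\<not> col {u, v} < k"
        using I uv lt by (auto simp: indep_sets_def A_def)
      ultimately show "col {u, v} = k" by simp
    qed
    then show ?thesis ..
  qed simp
qed

section \<open>Choice of the number of vertices\<close>

theorem proposition1:
  fixes k :: nat
  assumes "k \<ge> 1"
  shows "\<exists>c::real. \<forall>t m :: nat. t \<ge> 2 \<longrightarrow> m \<ge> 3 \<longrightarrow>
           real (ramsey_number k (complete_bipartite 2 t) (complete_graph m))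
             \<le> c * ((real m)\<^sup>2 * real t / (ln (real m))\<^sup>2)"
\<comment> \<open>The constant stays schematic until the final \<open>show\<close> sets it to
  \<open>2 * (512 * k)\<^sup>2\<close>, which does not involve \<open>t\<close> or
  \<open>m\<close>.\<close>
proof (intro exI allI impI)
  fix t m :: nat
  assume t: "t \<ge> 2" and m: "m \<ge> 3"
  \<comment> \<open>Chosen so that \<open>q * ln (sqrt m) / (256 * k)\<close> equals
    \<open>m\<close>. Rounding \<open>r\<close> up to an integer replaces \<open>q\<close> by
    \<open>q' \<ge> q\<close>.\<close>
  define q where "q = 512 * k * m / ln m"
  define r where "r = nat \<lceil>q\<^sup>2 * t\<rceil>"
  define q' where "q' = sqrt (r / t)"
  have ln0: "ln (real m) > 0" using m by simp
  have lnm: "ln (real m) = 2 * ln (sqrt m)" using m by (simp add: ln_sqrt)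
  also have "\<dots> \<le> 2 * sqrt m" using ln_less_self[of "sqrt m"] m by (simp add: less_imp_le)
  finally have ln_le: "ln (real m) \<le> 2 * sqrt m" .
  have "16 * k * sqrt m * ln m \<le> 16 * k * sqrt m * (2 * sqrt m)"
    using ln_le by (intro mult_left_mono) auto
  also have "\<dots> \<le> 512 * k * m" by simp
  \<comment> \<open>This turns \<open>ln (q' / (16 * k))\<close> into at least half of
    \<open>ln m\<close>.\<close>
  finally have q_sqrt: "16 * k * sqrt m \<le> q" using ln0 by (simp add: q_def field_simps)
  have "real (16 * k) * 1 \<le> 16 * k * sqrt m" using m by (intro mult_left_mono) auto
  then have q16: "q \<ge> 16 * k" using q_sqrt by simp
  then have q1: "q \<ge> 1" using assms by linarith
  have "q\<^sup>2 * t \<le> r" unfolding r_def by linarith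
  then have "q\<^sup>2 \<le> r / t" using t by (simp add: field_simps)
  then have qq': "q \<le> q'" unfolding q'_def using real_le_rsqrt by blast
  have ratio: "sqrt m \<le> q' / (16 * k)" using q_sqrt qq' assms by (simp add: field_simps)
  have "real m = q * ln (sqrt m) / (256 * k)"
    using assms ln0 lnm by (simp add: q_def field_simps)
  also have "\<dots> \<le> q' * ln (q' / (16 * k)) / (256 * k)"
    using qq' q1 ratio m by (intro divide_right_mono mult_mono ln_mono) auto
  finally have "ramsey_prop k (complete_bipartite 2 t) (complete_graph m) r"
    using assms t q16 qq' by (intro ramsey_prop_of_large[where q=q']) (auto simp: q'_def)
  then have "ramsey_number k (complete_bipartite 2 t) (complete_graph m) \<le> r"
    unfolding ramsey_number_def by (rule Least_le)
  \<comment> \<open>Rounding up adds at most 1, and \<open>1 \<le> q\<^sup>2 * t\<close>.\<close>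
  moreover have "r \<le> 2 * (q\<^sup>2 * t)"
  proof -
    have "1 * 1 \<le> q\<^sup>2 * real t" using q1 t by (intro mult_mono) auto
    then show ?thesis unfolding r_def by linarith
  qed
  moreover have "2 * (q\<^sup>2 * t) = 2 * (512 * k)\<^sup>2 * ((real m)\<^sup>2 * real t / (ln (real m))\<^sup>2)"
    by (simp add: q_def power_mult_distrib power_divide)
  ultimately show "real (ramsey_number k (complete_bipartite 2 t) (complete_graph m))
      \<le> 2 * (512 * k)\<^sup>2 * ((real m)\<^sup>2 * real t / (ln (real m))\<^sup>2)"
    by linarith
qed

end
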